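(* Let $F_k:\mathbb{R}^n\to\mathcal{I}$ ($k\in K:=\{1,\dots,m\}$) and $g_j:\mathbb{R}^n\to\mathbb{R}$ ($j\in J:=\{1,\dots,p\}$) be locally Lipschitz continuous, $S:=\{u\in\mathbb{R}^n:g_j(u)\le0,\ \forall j\in J\}$. Let $\varepsilon=(\varepsilon_1,\dots,\varepsilon_m)\in\mathbb{R}^m_+\setminus\{0\}$, let $\overline{u}\in S$ be a locally weak $\varepsilon$-quasi-minimal solution of the problem of minimizing $F=(F_1,\dots,F_m)$ over $S$, and suppose that BCQ holds on a neighbourhood of $\overline{u}$ (i.e. at every point of $S$ in some neighbourhood of $\overline u$). Suppose that $\epsilon_i>0$ for $i=1,2,\dots$ with $\epsilon_i\to0$. Then for any sequence $\{x_i\}$ in $S$ with $x_i\to\overline{u}$ as $i\to+\infty$, there is a subsequence $\{z_i\}$ of $\{x_i\}$ such that for every $z_i$ there is $y_i\in S$ satisfying: (i) $\|z_i-y_i\|\leq\sqrt{\epsilon_i}$; (ii) there exist $u_k^i\in\partial^0F_k(y_i)+\varepsilon_k\mathbb{B}^n$ for all $k\in K$, $v_j^i\in\partial^0g_j(y_i)$ for all $j\in J$, $\lambda^i=(\lambda_1^i,\dots,\lambda_m^i)\in\mathbb{R}_+^m$ with $\sum_{k\in K}\lambda_k^i=1$, and $\mu^i=(\mu_1^i,\dots,\mu_p^i)\in\mathbb{R}_+^p$ such that $$\Big\|\sum_{k\in K}\lambda_k^i u_k^i+\sum_{j\in J}\mu_j^iv_j^i\Big\|\leq\sqrt{\epsilon_i},\qquad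 \sum_{j\in J}\mu_j^ig_j(y_i)=0.$$
   Context: $\mathcal{I}$ is the set of all compact intervals $[\underline q,\overline q]$ with $\underline q\le\overline q$ real. For $Q=[\underline q,\overline q]\in\mathcal I$ put $q^c=\frac{\underline q+\overline q}{2}$ and $q^w=\frac{\overline q-\underline q}{2}$. Addition: $[\underline q,\overline q]+[\underline r,\overline r]=[\underline q+\underline r,\overline q+\overline r]$. Order: $Q\prec_{CW}R$ iff $q^c<r^c$ and $q^w<r^w$. $\mathbb{R}^m_+$ is the nonnegative orthant; $\mathbb{B}^n$ is the closed unit ball of $\mathbb{R}^n$; $\mathrm{co}$ denotes convex hull. An interval-valued function $f=[\underline f,\overline f]:\mathbb{R}^n\to\mathcal I$ is locally Lipschitz continuous if every point has a neighbourhood $U$ and $L>0$ with $\max\{|\underline f(u_1)-\underline f(u_2)|,|\overline f(u_1)-\overline f(u_2)|\}\le L\|u_1-u_2\|$ for $u_1,u_2\in U$ (equivalently, $\underline f,\overline f$ are locally Lipschitz). Write $f^c=\frac{\underline f+\overline f}{2}$, $f^w=\frac{\overline f-\underline f}{2}$. For locally Lipschitz $\psi:\mathbb{R}^n\to\mathbb{R}$, $\psi^0(z;w)=\limsup_{u\to z,\,t\to0^+}\frac{\psi(u+tw)-\psi(u)}{t}$ and $\partial^0\psi(z)=\{z^*\in\mathbb{R}^n:\langle z^*,w\rangle\le\psi^0(z;w)\ \forall w\}$ (Clarke gradient). For a locally Lipschitz interval-valued $f$, the weakly generalized gradient is $\partial^0f(u):=\mathrm{co}(\partial^0f^c(u)\cup\partial^0f^w(u))$.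 $z_0\in S$ is a locally weak $\varepsilon$-quasi-minimal solution if there is a neighbourhood $U(z_0)$ of $z_0$ such that there is no $z\in S\cap U(z_0)$ with $F_k(z)+[0,\varepsilon_k\|z-z_0\|]\prec_{CW}F_k(z_0)$ for all $k\in K$. For $u\in S$, $I(u):=\{j\in J:g_j(u)=0\}$. BCQ holds at $u\in S$ if there is no $\mu\in\mathbb{R}^p_+\setminus\{0\}$ with $\mu_j\ge 0$ for $j\in I(u)$, $\mu_j=0$ for $j\notin I(u)$ and $0\in\sum_{j\in J}\mu_j\partial^0g_j(u)$. *)

theory Defs
  imports "HOL-Analysis.Analysis" "HOL-Library.Interval"
begin

text \<open>
  The compact intervals are the type \<open>real interval\<close> of HOL-Library, with endpoints
  \<open>lower\<close>, \<open>upper\<close> and endpointwise addition. The index sets \<open>{1..m}\<close> and \<open>{1..p}\<close>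
  are finite types \<open>'m\<close> and \<open>'p\<close>.
\<close>

definition ctr :: "real interval \<Rightarrow> real" where
  "ctr Q = (lower Q + upper Q) / 2"

definition hwidth :: "real interval \<Rightarrow> real" where
  "hwidth Q = (upper Q - lower Q) / 2"

definition less_CW :: "real interval \<Rightarrow> real interval \<Rightarrow> bool"  (infix \<open>\<prec>\<^sub>C\<^sub>W\<close> 50) where
  "Q \<prec>\<^sub>C\<^sub>W R \<longleftrightarrow> ctr Q < ctr R \<and> hwidth Q < hwidth R"

definition locally_Lipschitz :: "(real ^ 'n \<Rightarrow> real) \<Rightarrow> bool" where
  "locally_Lipschitz \<psi> \<longleftrightarrow> (\<forall>x. \<exists>U L. open U \<and> x \<in> U \<and> L > 0 \<and> L-lipschitz_on U \<psi>)"

definition locally_Lipschitz_ivl :: "(real ^ 'n \<Rightarrow> real interval) \<Rightarrow> bool" where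
  "locally_Lipschitz_ivl f \<longleftrightarrow> (\<forall>x. \<exists>U L. open U \<and> x \<in> U \<and> L > 0 \<and>
     (\<forall>u1\<in>U. \<forall>u2\<in>U. max \<bar>lower (f u1) - lower (f u2)\<bar> \<bar>upper (f u1) - upper (f u2)\<bar>
        \<le> L * norm (u1 - u2)))"

text \<open>
  The upper limit is taken in \<open>ereal\<close>, where it always exists; for locally Lipschitz
  functions it is finite. The filter \<open>nhds z\<close> is not punctured: \<open>u = z\<close> is allowed.
\<close>

definition Clarke_deriv :: "(real ^ 'n \<Rightarrow> real) \<Rightarrow> real ^ 'n \<Rightarrow> real ^ 'n \<Rightarrow> ereal" where
  "Clarke_deriv \<psi> z w =
     Limsup (nhds z \<times>\<^sub>F at_right 0) (\<lambda>(u, t). ereal ((\<psi> (u + t *\<^sub>R w) - \<psi> u) / t))"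

definition Clarke_gradient :: "(real ^ 'n \<Rightarrow> real) \<Rightarrow> real ^ 'n \<Rightarrow> (real ^ 'n) set" where
  "Clarke_gradient \<psi> z = {s. \<forall>w. ereal (s \<bullet> w) \<le> Clarke_deriv \<psi> z w}"

definition weak_gradient :: "(real ^ 'n \<Rightarrow> real interval) \<Rightarrow> real ^ 'n \<Rightarrow> (real ^ 'n) set" where
  "weak_gradient f u = convex hull
     (Clarke_gradient (\<lambda>x. ctr (f x)) u \<union> Clarke_gradient (\<lambda>x. hwidth (f x)) u)"

definition feasible :: "('p \<Rightarrow> real ^ 'n \<Rightarrow> real) \<Rightarrow> (real ^ 'n) set" where
  "feasible g = {u. \<forall>j. g j u \<le> 0}"

definition locally_weak_quasi_minimal ::
  "('m::finite \<Rightarrow> real ^ 'n \<Rightarrow> real interval) \<Rightarrow> (real ^ 'n) set \<Rightarrow> real ^ 'm \<Rightarrow> real ^ 'n \<Rightarrow> bool" where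
  "locally_weak_quasi_minimal F S \<epsilon> z0 \<longleftrightarrow> z0 \<in> S \<and>
     (\<exists>U. open U \<and> z0 \<in> U \<and>
        \<not> (\<exists>z \<in> S \<inter> U. \<forall>k. F k z + Ivl 0 (\<epsilon> $ k * norm (z - z0)) \<prec>\<^sub>C\<^sub>W F k z0))"

definition active :: "('p \<Rightarrow> real ^ 'n \<Rightarrow> real) \<Rightarrow> real ^ 'n \<Rightarrow> 'p set" where
  "active g u = {j. g j u = 0}"

text \<open>The sum over \<open>j\<close> is the Minkowski sum of sets.\<close>

definition BCQ :: "('p::finite \<Rightarrow> real ^ 'n \<Rightarrow> real) \<Rightarrow> real ^ 'n \<Rightarrow> bool" where
  "BCQ g u \<longleftrightarrow> \<not> (\<exists>\<mu> :: real ^ 'p. \<mu> \<noteq> 0 \<and> (\<forall>j. 0 \<le> \<mu> $ j) \<and> (\<forall>j. j \<notin> active g u \<longrightarrow> \<mu> $ j = 0) \<and>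
     0 \<in> (\<Sum>j\<in>UNIV. (*\<^sub>R) (\<mu> $ j) ` Clarke_gradient (g j) u))"

end

theory Submission
  imports Defs
begin

text \<open>
  Every \<open>y\<^sub>i\<close> can be taken to be \<open>ubar\<close> itself: the local minimality of \<open>ubar\<close> says that near
  \<open>ubar\<close> one of the functions \<open>F\<^sub>k\<^sup>c\<close>, \<open>F\<^sub>k\<^sup>w\<close>, perturbed by \<open>(\<epsilon>\<^sub>k / 2) \<parallel>z - ubar\<parallel>\<close>, does not
  decrease, or an active constraint is violated. Hence in each direction one of the corresponding
  Clarke derivatives is nonnegative, and separating \<open>0\<close> from the convex hull of the (enlarged)
  Clarke gradients yields exact Fritz John multipliers at \<open>ubar\<close>. By BCQ the multipliers of the
  objectives do not all vanish, so they can be normalised.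
\<close>

section \<open>Sublinear functions\<close>

text \<open>A Hahn-Banach argument in approximate form. The slack \<open>d\<close> puts
  \<open>(y, p y - d)\<close> strictly below the closed convex epigraph, so a strictly separating
  hyperplane exists; its normal, rescaled to vertical component -1, gives \<open>s\<close>.\<close>

lemma sublinear_subgradient_approx:
  fixes p :: "'a::euclidean_space \<Rightarrow> real"
  assumes add: "\<And>v w. p (v + w) \<le> p v + p w"
    and scale: "\<And>c w. 0 \<le> c \<Longrightarrow> p (c *\<^sub>R w) = c * p w"
    and d: "0 < d"
  obtains s where "\<forall>w. s \<bullet> w \<le> p w" "p y - d < s \<bullet> y"
proof -
  let ?E = "epigraph UNIV p"
  have cvx: "convex_on UNIV p"
    unfolding convex_on_def by (metis UNIV_I add convex_UNIV scale)
  then have "continuous_on UNIV p"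
    by (simp add: convex_on_continuous)
  then have "closed ?E"
    unfolding epigraph_def
    by (auto intro!: closed_Collect_le continuous_intros continuous_on_compose2[of UNIV p])
  moreover have "convex ?E"
    using cvx by (simp add: convex_epigraph)
  moreover have "(y, p y - d) \<notin> ?E"
    using d by (simp add: mem_epigraph)
  ultimately obtain ab c where ab: "ab \<bullet> (y, p y - d) < c" "\<forall>q\<in>?E. c < ab \<bullet> q"
    using separating_hyperplane_closed_point by blast
  obtain a b where [simp]: "ab = (a, b)" by force
  have lower: "c < a \<bullet> w + b * r" if "p w \<le> r" for w r
    using bspec[OF ab(2), of "(w, r)"] that by (simp add: mem_epigraph)
  have upper: "a \<bullet> y + b * (p y - d) < c"
    using ab(1) by simp
  have p0: "p 0 = 0"
    using scale[of 0 0] by simp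
  \<comment> \<open>Comparing the separated point with \<open>(y, p y)\<close> directly above it
    shows that the hyperplane is not vertical.\<close>
  have "0 < b * d"
    using lower[of y "p y"] upper by (simp add: algebra_simps)
  then have b: "0 < b"
    using d by (simp add: zero_less_mult_iff)
  have "c < 0"
    using lower[of 0 0] p0 by simp
  have cone: "0 \<le> a \<bullet> w + b * p w" for w
  proof (rule ccontr)
    let ?q = "a \<bullet> w + b * p w"
    assume "\<not> 0 \<le> ?q"
    then have neg: "?q < 0" by simp
    \<comment> \<open>The ray through \<open>(w, p w)\<close> stays in the epigraph;
      \<open>?t\<close> is the factor at which it would meet the hyperplane at level
      \<open>c\<close>.\<close>
    let ?t = "c / ?q"
    have "0 \<le> ?t"
      using neg \<open>c < 0\<close> by (simp add: divide_nonpos_neg)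
    then have "c < a \<bullet> (?t *\<^sub>R w) + b * (?t * p w)"
      using lower[of "?t *\<^sub>R w" "?t * p w"] scale by simp
    also have "\<dots> = ?t * ?q"
      by (simp add: distrib_left mult.left_commute)
    also have "\<dots> = c"
      using neg by simp
    finally show False by simp
  qed
  show thesis
  proof
    have "(- (1 / b) *\<^sub>R a) \<bullet> w \<le> p w" for w
      using cone[of w] b by (simp add: field_simps)
    then show "\<forall>w. (- (1 / b) *\<^sub>R a) \<bullet> w \<le> p w" ..
    show "p y - d < (- (1 / b) *\<^sub>R a) \<bullet> y"
      using upper \<open>c < 0\<close> b by (simp add: field_simps)
  qed
qed

text \<open>Here \<open>p a\<close> plays the role of the support function of \<open>C a\<close>,
  bounded from above by it. If a hyperplane with normal \<open>w\<close> and gap \<open>b\<close>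
  separated 0 from the hull, every element of every \<open>C a\<close> would have inner product
  below \<open>- b\<close> with \<open>- w\<close>; \<open>approx\<close> with slack
  \<open>b\<close>, at an index where \<open>p a (- w)\<close> is nonnegative, produces an element
  that does not.\<close>

lemma zero_in_convex_hull_subgradients:
  fixes C :: "'i \<Rightarrow> 'a::euclidean_space set"
  assumes fin: "finite A" and ne: "A \<noteq> {}"
    and C: "\<And>a. a \<in> A \<Longrightarrow> compact (C a)" "\<And>a. a \<in> A \<Longrightarrow> convex (C a)"
    and approx: "\<And>a w d. \<lbrakk>a \<in> A; 0 < d\<rbrakk> \<Longrightarrow> \<exists>s\<in>C a. p a w - d < s \<bullet> w"
    and nonneg: "\<And>w. \<exists>a\<in>A. 0 \<le> p a w"
  obtains c s where "\<And>a. a \<in> A \<Longrightarrow> 0 \<le> c a" "sum c A = 1" "\<And>a. a \<in> A \<Longrightarrow> s a \<in> C a"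
    "(\<Sum>a\<in>A. c a *\<^sub>R s a) = (0::'a)"
proof -
  have Cne: "C a \<noteq> {}" if "a \<in> A" for a
    using approx[OF that, of 1] by auto
  let ?H = "convex hull (\<Union>(C ` A))"
  have "compact (\<Union>(C ` A))"
    using fin C by (intro compact_UN) auto
  then have "closed ?H"
    by (simp add: compact_convex_hull compact_imp_closed)
  have "0 \<in> ?H"
  proof (rule ccontr)
    assume "0 \<notin> ?H"
    then obtain w b where b: "0 < b" "\<And>q. q \<in> ?H \<Longrightarrow> b < w \<bullet> q"
      using separating_hyperplane_closed_0[OF convex_convex_hull \<open>closed ?H\<close>] by blast
    obtain a where a: "a \<in> A" "0 \<le> p a (- w)"
      using nonneg by blast
    obtain s where s: "s \<in> C a" "p a (- w) - b < s \<bullet> (- w)"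
      using approx[OF a(1) b(1)] by blast
    have "s \<in> ?H"
      using a(1) s(1) by (auto intro: hull_inc)
    then show False
      using b(2) s(2) a(2) by (fastforce simp: inner_commute)
  qed
  then obtain c s where "\<forall>a\<in>A. 0 \<le> c a" "sum c A = 1" "\<forall>a\<in>A. s a \<in> C a"
      "(\<Sum>a\<in>A. c a *\<^sub>R s a) = 0"
    using convex_hull_finite_union[OF fin, of C] C(2) Cne by force
  then show thesis
    using that by blast
qed

section \<open>Clarke derivatives\<close>

abbreviation diff_quot :: "(real ^ 'n \<Rightarrow> real) \<Rightarrow> real ^ 'n \<Rightarrow> (real ^ 'n) \<times> real \<Rightarrow> real" where
  "diff_quot \<psi> w \<equiv> \<lambda>(u, t). (\<psi> (u + t *\<^sub>R w) - \<psi> u) / t"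

lemma Clarke_deriv_eq_Limsup:
  "Clarke_deriv \<psi> z w = Limsup (nhds z \<times>\<^sub>F at_right 0) (\<lambda>q. ereal (diff_quot \<psi> w q))"
  unfolding Clarke_deriv_def by (simp add: case_prod_beta')

lemma Clarke_deriv_lessD:
  "Clarke_deriv \<psi> z w < ereal c \<Longrightarrow> \<forall>\<^sub>F q in nhds z \<times>\<^sub>F at_right 0. diff_quot \<psi> w q < c"
  unfolding Clarke_deriv_eq_Limsup by (auto dest: Limsup_lessD)

lemma Clarke_deriv_leI:
  "\<forall>\<^sub>F q in nhds z \<times>\<^sub>F at_right 0. diff_quot \<psi> w q \<le> c \<Longrightarrow> Clarke_deriv \<psi> z w \<le> ereal c"
  unfolding Clarke_deriv_eq_Limsup by (rule Limsup_bounded) simp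

lemma nhds_at_right_nontrivial: "nhds z \<times>\<^sub>F at_right (0::real) \<noteq> bot"
  by (simp add: prod_filter_eq_bot)

lemma eventually_at_right_prod_pos: "\<forall>\<^sub>F q in nhds z \<times>\<^sub>F at_right (0::real). 0 < snd q"
  using filterlim_snd eventually_at_right_less unfolding filterlim_iff by blast

text \<open>Moving the base point from u to u + t w stays compatible with the filter that defines
  the Clarke derivative. This gives the Lipschitz bounds and, by changing the base point,
  subadditivity.\<close>

lemma tendsto_shift_direction:
  fixes z w :: "'a::real_normed_vector"
  shows "LIM q nhds z \<times>\<^sub>F at_right 0. fst q + snd q *\<^sub>R w :> nhds z"
proof -
  have 1: "filterlim fst (nhds z) (nhds z \<times>\<^sub>F at_right (0::real))"
    by (rule filterlim_fst)
  have "filterlim snd (at_right 0) (nhds z \<times>\<^sub>F at_right (0::real))"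
    by (rule filterlim_snd)
  then have 2: "(snd \<longlongrightarrow> 0) (nhds z \<times>\<^sub>F at_right (0::real))"
    by (simp add: filterlim_at)
  have "((\<lambda>q. fst q + snd q *\<^sub>R w) \<longlongrightarrow> z + 0 *\<^sub>R w) (nhds z \<times>\<^sub>F at_right 0)"
    by (intro tendsto_intros 1 2)
  then show ?thesis by simp
qed

lemma Clarke_deriv_bounds:
  assumes "open U" "z \<in> U" "L-lipschitz_on U \<psi>"
  shows "Clarke_deriv \<psi> z w \<le> ereal (L * norm w)" "ereal (- (L * norm w)) \<le> Clarke_deriv \<psi> z w"
proof -
  have "\<forall>\<^sub>F q in nhds z \<times>\<^sub>F at_right 0. fst q \<in> U"
    using filterlim_fst eventually_nhds_in_open[OF assms(1,2)] unfolding filterlim_iff by blast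
  moreover have "\<forall>\<^sub>F q in nhds z \<times>\<^sub>F at_right 0. fst q + snd q *\<^sub>R w \<in> U"
    using tendsto_shift_direction eventually_nhds_in_open[OF assms(1,2)]
    unfolding filterlim_iff by blast
  ultimately have *: "\<forall>\<^sub>F q in nhds z \<times>\<^sub>F at_right 0. \<bar>diff_quot \<psi> w q\<bar> \<le> L * norm w"
    using eventually_at_right_prod_pos
  proof eventually_elim
    case (elim q)
    then have "dist (\<psi> (fst q + snd q *\<^sub>R w)) (\<psi> (fst q)) \<le> L * dist (fst q + snd q *\<^sub>R w) (fst q)"
      using lipschitz_onD[OF assms(3)] by blast
    then show ?case
      using elim by (simp add: split_beta' dist_norm field_simps)
  qed
  show "Clarke_deriv \<psi> z w \<le> ereal (L * norm w)"
    using * by (intro Clarke_deriv_leI, elim eventually_mono) (rule abs_le_D1)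
  have "\<forall>\<^sub>F q in nhds z \<times>\<^sub>F at_right 0. - (L * norm w) \<le> diff_quot \<psi> w q"
    using * by (rule eventually_mono) linarith
  then show "ereal (- (L * norm w)) \<le> Clarke_deriv \<psi> z w"
    unfolding Clarke_deriv_eq_Limsup by (intro le_Limsup nhds_at_right_nontrivial) simp
qed

text \<open>\<open>real_of_ereal\<close> sends infinite values to 0, but the preceding bounds rule
  them out for locally Lipschitz functions, so the sublinear calculus can be done in the
  reals.\<close>

abbreviation Clarke_real :: "(real ^ 'n \<Rightarrow> real) \<Rightarrow> real ^ 'n \<Rightarrow> real ^ 'n \<Rightarrow> real" where
  "Clarke_real \<psi> z w \<equiv> real_of_ereal (Clarke_deriv \<psi> z w)"

lemma ereal_Clarke_real:
  assumes "locally_Lipschitz \<psi>"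
  shows "ereal (Clarke_real \<psi> z w) = Clarke_deriv \<psi> z w"
proof -
  obtain U L where "open U" "z \<in> U" "L-lipschitz_on U \<psi>"
    using assms unfolding locally_Lipschitz_def by blast
  from Clarke_deriv_bounds[OF this, of w] show ?thesis
    by (cases "Clarke_deriv \<psi> z w") auto
qed

lemma Clarke_deriv_less_iff:
  assumes "locally_Lipschitz \<psi>"
  shows "Clarke_deriv \<psi> z w < ereal c \<longleftrightarrow> Clarke_real \<psi> z w < c"
  by (subst ereal_Clarke_real[OF assms, symmetric]) simp

text \<open>The increment in direction v + w is split at u + t w. The first piece is a quotient in
  direction v whose moving base point still tends to z, which the upper limit over base points
  already controls.\<close>

lemma Clarke_real_add:
  assumes L: "locally_Lipschitz \<psi>"
  shows "Clarke_real \<psi> z (v + w) \<le> Clarke_real \<psi> z v + Clarke_real \<psi> z w"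
proof (rule field_le_epsilon)
  fix d :: real assume "0 < d"
  let ?a = "Clarke_real \<psi> z v + d / 2" and ?b = "Clarke_real \<psi> z w + d / 2"
  have "Clarke_deriv \<psi> z v < ereal ?a" "Clarke_deriv \<psi> z w < ereal ?b"
    using \<open>0 < d\<close> by (simp_all add: Clarke_deriv_less_iff[OF L])
  then have ev: "\<forall>\<^sub>F q in nhds z \<times>\<^sub>F at_right 0. diff_quot \<psi> v q < ?a"
      "\<forall>\<^sub>F q in nhds z \<times>\<^sub>F at_right 0. diff_quot \<psi> w q < ?b"
    by (auto dest!: Clarke_deriv_lessD)
  have "LIM q nhds z \<times>\<^sub>F at_right 0. (fst q + snd q *\<^sub>R w, snd q) :> nhds z \<times>\<^sub>F at_right 0"
    by (rule filterlim_Pair[OF tendsto_shift_direction filterlim_snd])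
  with ev(1) have "\<forall>\<^sub>F q in nhds z \<times>\<^sub>F at_right 0. diff_quot \<psi> v (fst q + snd q *\<^sub>R w, snd q) < ?a"
    unfolding filterlim_iff by blast
  with ev(2) have "\<forall>\<^sub>F q in nhds z \<times>\<^sub>F at_right 0. diff_quot \<psi> (v + w) q \<le> ?a + ?b"
  proof eventually_elim
    case (elim q)
    have "diff_quot \<psi> (v + w) q = diff_quot \<psi> v (fst q + snd q *\<^sub>R w, snd q) + diff_quot \<psi> w q"
      by (simp add: split_beta' scaleR_add_right add_ac flip: add_divide_distrib)
    then show ?case using elim by linarith
  qed
  then have "ereal (Clarke_real \<psi> z (v + w)) \<le> ereal (?a + ?b)"
    unfolding ereal_Clarke_real[OF L] by (rule Clarke_deriv_leI)
  then show "Clarke_real \<psi> z (v + w) \<le> Clarke_real \<psi> z v + Clarke_real \<psi> z w + d"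
    by simp
qed

text \<open>The substitution of c t for t turns the quotient in direction c w into c times the
  quotient in direction w.\<close>

lemma Clarke_real_scale_le:
  assumes L: "locally_Lipschitz \<psi>" and c: "0 < c"
  shows "Clarke_real \<psi> z (c *\<^sub>R w) \<le> c * Clarke_real \<psi> z w"
proof (rule field_le_epsilon)
  fix d :: real assume "0 < d"
  let ?b = "Clarke_real \<psi> z w + d / c"
  have "Clarke_deriv \<psi> z w < ereal ?b"
    using \<open>0 < d\<close> c by (simp add: Clarke_deriv_less_iff[OF L])
  then have ev: "\<forall>\<^sub>F q in nhds z \<times>\<^sub>F at_right 0. diff_quot \<psi> w q < ?b"
    by (rule Clarke_deriv_lessD)
  have "filterlim (\<lambda>t. c * t) (at_right 0) (at_right (0::real))"
    using c by (auto simp: filterlim_at eventually_at_right_less intro!: tendsto_eq_intros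
        intro: eventually_mono[OF eventually_at_right_less[of 0]])
  then have "LIM q nhds z \<times>\<^sub>F at_right 0. (fst q, c * snd q) :> nhds z \<times>\<^sub>F at_right 0"
    by (intro filterlim_Pair filterlim_fst filterlim_compose[OF _ filterlim_snd])
  with ev have "\<forall>\<^sub>F q in nhds z \<times>\<^sub>F at_right 0. diff_quot \<psi> w (fst q, c * snd q) < ?b"
    unfolding filterlim_iff by blast
  then have "\<forall>\<^sub>F q in nhds z \<times>\<^sub>F at_right 0. diff_quot \<psi> (c *\<^sub>R w) q \<le> c * ?b"
  proof eventually_elim
    case (elim q)
    have "diff_quot \<psi> (c *\<^sub>R w) q = c * diff_quot \<psi> w (fst q, c * snd q)"
      using c by (simp add: split_beta' mult.commute)
    also have "\<dots> \<le> c * ?b"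
      by (rule mult_left_mono[OF less_imp_le[OF elim] less_imp_le[OF c]])
    finally show ?case .
  qed
  then have "ereal (Clarke_real \<psi> z (c *\<^sub>R w)) \<le> ereal (c * ?b)"
    unfolding ereal_Clarke_real[OF L] by (rule Clarke_deriv_leI)
  then show "Clarke_real \<psi> z (c *\<^sub>R w) \<le> c * Clarke_real \<psi> z w + d"
    using c by (simp add: algebra_simps)
qed

lemma Clarke_real_scale:
  assumes L: "locally_Lipschitz \<psi>" and c: "0 \<le> c"
  shows "Clarke_real \<psi> z (c *\<^sub>R w) = c * Clarke_real \<psi> z w"
proof (cases "c = 0")
  case True
  obtain U K where "open U" "z \<in> U" "K-lipschitz_on U \<psi>"
    using L unfolding locally_Lipschitz_def by blast
  then have "Clarke_deriv \<psi> z 0 = ereal 0"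
    using Clarke_deriv_bounds[of U z K \<psi> 0] by (intro antisym) simp_all
  with True show ?thesis
    by simp
next
  case False
  with c have "0 < c" by simp
  \<comment> \<open>The reverse inequality is the same estimate for the factor 1 / c in direction c
    w.\<close>
  have "Clarke_real \<psi> z w \<le> (1 / c) * Clarke_real \<psi> z (c *\<^sub>R w)"
    using Clarke_real_scale_le[OF L, of "1 / c" z "c *\<^sub>R w"] \<open>0 < c\<close> by simp
  then show ?thesis
    using Clarke_real_scale_le[OF L \<open>0 < c\<close>, of z w] \<open>0 < c\<close> by (simp add: field_simps)
qed

section \<open>Clarke gradients as nonempty compact convex sets\<close>

lemma mem_Clarke_gradient_iff:
  assumes "locally_Lipschitz \<psi>"
  shows "s \<in> Clarke_gradient \<psi> z \<longleftrightarrow> (\<forall>w. s \<bullet> w \<le> Clarke_real \<psi> z w)"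
proof -
  have "ereal (s \<bullet> w) \<le> Clarke_deriv \<psi> z w \<longleftrightarrow> s \<bullet> w \<le> Clarke_real \<psi> z w" for w
    by (subst ereal_Clarke_real[OF assms, symmetric]) simp
  then show ?thesis
    by (simp add: Clarke_gradient_def)
qed

text \<open>The nontrivial half of the fact that the Clarke derivative is the support function of
  the Clarke gradient.\<close>

lemma Clarke_gradient_approx:
  assumes L: "locally_Lipschitz \<psi>" and "0 < d"
  obtains s where "s \<in> Clarke_gradient \<psi> z" "Clarke_real \<psi> z w - d < s \<bullet> w"
proof -
  obtain s where s: "\<forall>v. s \<bullet> v \<le> Clarke_real \<psi> z v" "Clarke_real \<psi> z w - d < s \<bullet> w"
    by (rule sublinear_subgradient_approx[of "Clarke_real \<psi> z" d w,
          OF Clarke_real_add[OF L] Clarke_real_scale[OF L] \<open>0 < d\<close>])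
  have "s \<in> Clarke_gradient \<psi> z"
    using s(1) unfolding mem_Clarke_gradient_iff[OF L] .
  then show thesis
    by (rule that[OF _ s(2)])
qed

lemma Clarke_gradient_nonempty:
  assumes "locally_Lipschitz \<psi>"
  shows "Clarke_gradient \<psi> z \<noteq> {}"
proof -
  obtain s where "s \<in> Clarke_gradient \<psi> z"
    using Clarke_gradient_approx[OF assms zero_less_one, of z 0] by metis
  then show ?thesis by blast
qed

lemma compact_Clarke_gradient:
  assumes L: "locally_Lipschitz \<psi>"
  shows "compact (Clarke_gradient \<psi> z)"
proof -
  obtain U K where U: "open U" "z \<in> U" "K-lipschitz_on U \<psi>"
    using L unfolding locally_Lipschitz_def by blast
  have "norm s \<le> K" if "s \<in> Clarke_gradient \<psi> z" for s
  proof -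
    \<comment> \<open>Testing the subgradient \<open>s\<close> in its own direction bounds its norm
      by the Lipschitz constant.\<close>
    have "ereal (s \<bullet> s) \<le> ereal (K * norm s)"
      using that Clarke_deriv_bounds(1)[OF U, of s] unfolding Clarke_gradient_def
      by (blast intro: order_trans)
    then show ?thesis
      using lipschitz_on_nonneg[OF U(3)]
      by (cases "s = 0") (auto simp: power2_norm_eq_inner[symmetric] power2_eq_square)
  qed
  then have "bounded (Clarke_gradient \<psi> z)"
    unfolding bounded_iff by blast
  moreover have "closed (Clarke_gradient \<psi> z)"
  proof -
    have "Clarke_gradient \<psi> z = {s. \<forall>w. s \<bullet> w \<le> Clarke_real \<psi> z w}"
      using mem_Clarke_gradient_iff[OF L] by blast
    then show ?thesis
      by (simp add: closed_Collect_all closed_Collect_le continuous_intros)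
  qed
  ultimately show ?thesis
    by (simp add: compact_eq_bounded_closed)
qed

lemma convex_Clarke_gradient:
  assumes L: "locally_Lipschitz \<psi>"
  shows "convex (Clarke_gradient \<psi> z)"
  unfolding convex_def
  by (auto simp: mem_Clarke_gradient_iff[OF L] inner_add_left intro!: convex_bound_le)

section \<open>A Fritz John rule\<close>

text \<open>If all the perturbed derivatives were negative, finiteness of \<open>A\<close> would
  give one small t at which every perturbed function drops below its value at z, against
  \<open>min\<close>.\<close>

lemma ex_nonneg_Clarke_direction:
  assumes fin: "finite A" and L: "\<And>a. a \<in> A \<Longrightarrow> locally_Lipschitz (\<psi> a)"
    and min: "\<forall>\<^sub>F x in nhds z. \<exists>a\<in>A. \<psi> a z \<le> \<psi> a x + c a * norm (x - z)"
  shows "\<exists>a\<in>A. 0 \<le> Clarke_real (\<psi> a) z w + c a * norm w"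
proof (rule ccontr)
  assume "\<not> ?thesis"
  then have neg: "\<And>a. a \<in> A \<Longrightarrow> Clarke_real (\<psi> a) z w < - (c a * norm w)"
    by force
  have "\<forall>\<^sub>F t in at_right 0. diff_quot (\<psi> a) w (z, t) < - (c a * norm w)" if "a \<in> A" for a
  proof -
    have "Clarke_deriv (\<psi> a) z w < ereal (- (c a * norm w))"
      using neg[OF that] by (simp add: Clarke_deriv_less_iff[OF L[OF that]])
    then have "\<forall>\<^sub>F q in nhds z \<times>\<^sub>F at_right 0. diff_quot (\<psi> a) w q < - (c a * norm w)"
      by (rule Clarke_deriv_lessD)
    \<comment> \<open>Since \<open>nhds z\<close> is not punctured, the base point may be held fixed
      at \<open>z\<close>.\<close>
    moreover have "LIM t at_right 0. (z, t) :> nhds z \<times>\<^sub>F at_right (0::real)"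
      by (rule filterlim_Pair[OF tendsto_const filterlim_ident])
    ultimately show ?thesis
      unfolding filterlim_iff by blast
  qed
  then have "\<forall>\<^sub>F t in at_right 0. \<forall>a\<in>A. diff_quot (\<psi> a) w (z, t) < - (c a * norm w)"
    by (intro eventually_ball_finite[OF fin]) blast
  moreover have "((\<lambda>t. z + t *\<^sub>R w) \<longlongrightarrow> z) (at_right 0)"
    by (auto intro!: tendsto_eq_intros)
  then have "\<forall>\<^sub>F t in at_right 0. \<exists>a\<in>A. \<psi> a z \<le> \<psi> a (z + t *\<^sub>R w) + c a * norm (z + t *\<^sub>R w - z)"
    using min unfolding filterlim_iff by blast
  ultimately have "\<forall>\<^sub>F t in at_right (0::real). False"
    using eventually_at_right_less[of 0]
  proof eventually_elim
    case (elim t)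
    then obtain a where a: "a \<in> A" "\<psi> a z \<le> \<psi> a (z + t *\<^sub>R w) + c a * norm (z + t *\<^sub>R w - z)"
      by blast
    with elim(1) have "(\<psi> a (z + t *\<^sub>R w) - \<psi> a z) / t < - (c a * norm w)"
      by auto
    with a(2) \<open>0 < t\<close> show False
      by (simp add: field_simps)
  qed
  then show False by simp
qed

text \<open>The term \<open>c a * norm w\<close> is the support function of
  \<open>cball 0 (c a)\<close>, so the perturbed Clarke derivative is that of the Clarke gradient
  enlarged by this ball.\<close>

lemma Fritz_John:
  fixes \<psi> :: "'i \<Rightarrow> real ^ 'n \<Rightarrow> real"
  assumes fin: "finite A" and L: "\<And>a. a \<in> A \<Longrightarrow> locally_Lipschitz (\<psi> a)"
    and c: "\<And>a. a \<in> A \<Longrightarrow> 0 \<le> c a"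
    and min: "\<forall>\<^sub>F x in nhds z. \<exists>a\<in>A. \<psi> a z \<le> \<psi> a x + c a * norm (x - z)"
  obtains \<nu> s where "\<And>a. a \<in> A \<Longrightarrow> 0 \<le> \<nu> a" "sum \<nu> A = 1"
    "\<And>a. a \<in> A \<Longrightarrow> s a \<in> Clarke_gradient (\<psi> a) z + cball 0 (c a)"
    "(\<Sum>a\<in>A. \<nu> a *\<^sub>R s a) = 0"
proof (rule zero_in_convex_hull_subgradients[OF fin,
      where C = "\<lambda>a. Clarke_gradient (\<psi> a) z + cball 0 (c a)"
        and p = "\<lambda>a w. Clarke_real (\<psi> a) z w + c a * norm w"])
  show nonneg: "\<exists>a\<in>A. 0 \<le> Clarke_real (\<psi> a) z w + c a * norm w" for w
    by (rule ex_nonneg_Clarke_direction[OF fin L min])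
  show "A \<noteq> {}"
    using nonneg[of 0] by blast
  fix a assume a: "a \<in> A"
  show "compact (Clarke_gradient (\<psi> a) z + cball 0 (c a))"
  proof -
    have *: "S + T = {x + y | x y. x \<in> S \<and> y \<in> T}" for S T :: "(real ^ 'n) set"
      by (auto simp: set_plus_def)
    show ?thesis
      unfolding * by (rule compact_sums[OF compact_Clarke_gradient[OF L[OF a]] compact_cball])
  qed
  show "convex (Clarke_gradient (\<psi> a) z + cball 0 (c a))"
    by (intro convex_set_plus convex_Clarke_gradient L a convex_cball)
  fix w :: "real ^ 'n" and d :: real assume "0 < d"
  obtain s where s: "s \<in> Clarke_gradient (\<psi> a) z" "Clarke_real (\<psi> a) z w - d < s \<bullet> w"
    by (rule Clarke_gradient_approx[OF L[OF a] \<open>0 < d\<close>])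
  \<comment> \<open>The point of the ball with the largest inner product with
    \<open>w\<close>.\<close>
  let ?b = "c a *\<^sub>R sgn w"
  have "?b \<in> cball 0 (c a)"
    using c[OF a] by (simp add: norm_sgn)
  moreover have "sgn w \<bullet> w = norm w"
    by (cases "w = 0") (simp_all add: sgn_div_norm power2_norm_eq_inner[symmetric] power2_eq_square)
  ultimately show "\<exists>s\<in>Clarke_gradient (\<psi> a) z + cball 0 (c a).
      Clarke_real (\<psi> a) z w + c a * norm w - d < s \<bullet> w"
    using s by (intro bexI[of _ "s + ?b"]) (auto simp: inner_add_left)
qed (use that in blast)

section \<open>The multiplier rule\<close>

lemma locally_Lipschitz_ctr_hwidth:
  assumes "locally_Lipschitz_ivl f"
  shows "locally_Lipschitz (\<lambda>x. ctr (f x))" "locally_Lipschitz (\<lambda>x. hwidth (f x))"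
proof -
  have "\<exists>U L. open U \<and> z \<in> U \<and> L > 0 \<and>
      L-lipschitz_on U (\<lambda>x. ctr (f x)) \<and> L-lipschitz_on U (\<lambda>x. hwidth (f x))" for z
  proof -
    obtain U L where U: "open U" "z \<in> U" "L > 0"
      and lip: "\<And>u v. \<lbrakk>u \<in> U; v \<in> U\<rbrakk> \<Longrightarrow>
        max \<bar>lower (f u) - lower (f v)\<bar> \<bar>upper (f u) - upper (f v)\<bar> \<le> L * norm (u - v)"
      using assms unfolding locally_Lipschitz_ivl_def by meson
    have "dist (ctr (f u)) (ctr (f v)) \<le> L * dist u v \<and>
        dist (hwidth (f u)) (hwidth (f v)) \<le> L * dist u v" if "u \<in> U" "v \<in> U" for u v
      using lip[OF that] unfolding ctr_def hwidth_def dist_norm real_norm_def by argo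
    then show ?thesis
      using U unfolding lipschitz_on_def by (meson less_imp_le)
  qed
  then show "locally_Lipschitz (\<lambda>x. ctr (f x))" "locally_Lipschitz (\<lambda>x. hwidth (f x))"
    unfolding locally_Lipschitz_def by meson+
qed

lemma locally_Lipschitz_isCont:
  assumes "locally_Lipschitz \<psi>"
  shows "isCont \<psi> z"
proof -
  obtain U L where "open U" "z \<in> U" "L-lipschitz_on U \<psi>"
    using assms unfolding locally_Lipschitz_def by blast
  then show ?thesis
    using continuous_on_eq_continuous_at lipschitz_on_continuous_on by blast
qed

text \<open>Adding [0, r] moves both centre and half-width by r / 2, which is the origin of the
  halved \<epsilon> below.\<close>

lemma less_CW_add_Ivl_iff:
  assumes "0 \<le> r"
  shows "Q + Ivl 0 r \<prec>\<^sub>C\<^sub>W R \<longleftrightarrow> ctr Q + r / 2 < ctr R \<and> hwidth Q + r / 2 < hwidth R"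
proof -
  have "lower (Ivl 0 r) = 0" "upper (Ivl 0 r) = r"
    using assms by (simp_all add: lower.rep_eq upper.rep_eq Ivl.rep_eq)
  then have "ctr (Q + Ivl 0 r) = ctr Q + r / 2" "hwidth (Q + Ivl 0 r) = hwidth Q + r / 2"
    by (simp_all add: ctr_def hwidth_def add_divide_distrib diff_divide_distrib)
  then show ?thesis
    by (simp add: less_CW_def)
qed

text \<open>Passes from the radius c / 2 of the Fritz John rule to the scaled unit ball of the final
  statement. For c = 0 both sides are the singleton of 0.\<close>

lemma cball_half_subset_scaleR_cball:
  fixes c :: real
  assumes "0 \<le> c"
  shows "cball (0 :: 'a::real_normed_vector) (c / 2) \<subseteq> (*\<^sub>R) c ` cball 0 1"
proof (cases "c = 0")
  case False
  then have "(*\<^sub>R) c ` cball (0 :: 'a) 1 = cball 0 c"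
    using assms cball_scale[of c "0 :: 'a" 1] by simp
  then show ?thesis
    using assms by (simp add: subset_cball)
qed (auto intro!: image_eqI[of _ _ 0])

text \<open>Merges the centre and half-width terms of one objective into a single weighted vector.
  If the total weight is 0, both weights vanish and any element of \<open>W\<close> serves.\<close>

lemma convex_combination_scaled:
  assumes "convex W" "s \<in> W" "t \<in> W" "0 \<le> \<alpha>" "0 \<le> \<beta>"
  shows "\<exists>u\<in>W. (\<alpha> + \<beta>) *\<^sub>R u = \<alpha> *\<^sub>R s + \<beta> *\<^sub>R t"
proof (cases "\<alpha> + \<beta> = 0")
  case True
  with assms show ?thesis by (auto simp: add_nonneg_eq_0_iff)
next
  case False
  let ?u = "(\<alpha> / (\<alpha> + \<beta>)) *\<^sub>R s + (\<beta> / (\<alpha> + \<beta>)) *\<^sub>R t"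
  have "?u \<in> W"
    using assms False by (intro convexD) (auto simp flip: add_divide_distrib)
  moreover have "(\<alpha> + \<beta>) *\<^sub>R ?u = \<alpha> *\<^sub>R s + \<beta> *\<^sub>R t"
    using False by (simp add: scaleR_add_right)
  ultimately show ?thesis by blast
qed

text \<open>A common index type, so that centres, half-widths and constraints form one family for
  the Fritz John rule.\<close>

datatype ('m, 'p) part = Ctr 'm | Width 'm | Constr 'p

lemma sum_parts:
  fixes h :: "('m::finite, 'p::finite) part \<Rightarrow> 'a::comm_monoid_add"
  shows "sum h (range Ctr \<union> range Width \<union> Constr ` J) =
    (\<Sum>k\<in>UNIV. h (Ctr k)) + (\<Sum>k\<in>UNIV. h (Width k)) + (\<Sum>j\<in>J. h (Constr j))"
proof -
  have "sum h (range Ctr \<union> range Width \<union> Constr ` J) =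
      sum h (range Ctr) + sum h (range Width) + sum h (Constr ` J)"
    by (subst sum.union_disjoint; (subst sum.union_disjoint)?) auto
  then show ?thesis
    by (simp add: sum.reindex inj_on_def)
qed

text \<open>Only active constraints enter the Fritz John family. The others get multiplier 0, which
  yields complementarity.\<close>

lemma KKT_of_locally_weak_quasi_minimal:
  fixes F :: "'m::finite \<Rightarrow> real ^ 'n \<Rightarrow> real interval"
    and g :: "'p::finite \<Rightarrow> real ^ 'n \<Rightarrow> real"
    and \<epsilon> :: "real ^ 'm"
  assumes F: "\<And>k. locally_Lipschitz_ivl (F k)" and g: "\<And>j. locally_Lipschitz (g j)"
    and eps: "\<And>k. 0 \<le> \<epsilon> $ k"
    and min: "locally_weak_quasi_minimal F (feasible g) \<epsilon> z"
    and BCQ: "BCQ g z"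
  obtains u v and lam :: "real ^ 'm" and \<mu> :: "real ^ 'p" where
    "\<forall>k. u k \<in> weak_gradient (F k) z + (*\<^sub>R) (\<epsilon> $ k) ` cball 0 1"
    "\<forall>j. v j \<in> Clarke_gradient (g j) z"
    "\<forall>k. 0 \<le> lam $ k" "(\<Sum>k\<in>UNIV. lam $ k) = 1" "\<forall>j. 0 \<le> \<mu> $ j"
    "(\<Sum>k\<in>UNIV. lam $ k *\<^sub>R u k) + (\<Sum>j\<in>UNIV. \<mu> $ j *\<^sub>R v j) = 0"
    "(\<Sum>j\<in>UNIV. \<mu> $ j * g j z) = 0"
proof -
  obtain U where zS: "z \<in> feasible g" and U: "open U" "z \<in> U"
    and noCW: "\<And>x. \<lbrakk>x \<in> feasible g; x \<in> U\<rbrakk> \<Longrightarrow>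
      \<exists>k. \<not> F k x + Ivl 0 (\<epsilon> $ k * norm (x - z)) \<prec>\<^sub>C\<^sub>W F k z"
    using min unfolding locally_weak_quasi_minimal_def by blast
  define \<psi> where "\<psi> = case_part (\<lambda>k x. ctr (F k x)) (\<lambda>k x. hwidth (F k x)) g"
  define c where "c = case_part (\<lambda>k. \<epsilon> $ k / 2) (\<lambda>k. \<epsilon> $ k / 2) (\<lambda>j :: 'p. 0)"
  define A :: "('m, 'p) part set" where "A = range Ctr \<union> range Width \<union> Constr ` active g z"
  have \<psi>_simps [simp]: "\<psi> (Ctr k) = (\<lambda>x. ctr (F k x))" "\<psi> (Width k) = (\<lambda>x. hwidth (F k x))"
      "\<psi> (Constr j) = g j" for k j
    by (simp_all add: \<psi>_def)
  have c_simps [simp]: "c (Ctr k) = \<epsilon> $ k / 2" "c (Width k) = \<epsilon> $ k / 2" "c (Constr j) = 0" for k j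
    by (simp_all add: c_def)
  have "finite A"
    unfolding A_def by (intro finite_UnI finite_imageI finite)
  have lip: "locally_Lipschitz (\<psi> a)" for a
    using locally_Lipschitz_ctr_hwidth[OF F] g by (cases a) auto
  have c0: "0 \<le> c a" for a
    using eps by (cases a) auto
  \<comment> \<open>By continuity an inactive constraint cannot be violated near
    \<open>z\<close>.\<close>
  have "\<forall>\<^sub>F x in nhds z. g j x < 0" if "j \<notin> active g z" for j
  proof -
    have "g j z < 0"
      using zS that by (auto simp: feasible_def active_def less_le)
    moreover have "(g j \<longlongrightarrow> g j z) (nhds z)"
      using locally_Lipschitz_isCont[OF g] by (simp add: continuous_within tendsto_nhds_iff)
    ultimately show ?thesis
      by (rule order_tendstoD(2)[rotated])
  qed
  then have "\<forall>\<^sub>F x in nhds z. \<forall>j\<in>- active g z. g j x < 0"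
    by (intro eventually_ball_finite) auto
  then have ev: "\<forall>\<^sub>F x in nhds z. \<exists>a\<in>A. \<psi> a z \<le> \<psi> a x + c a * norm (x - z)"
    using eventually_nhds_in_open[OF U]
  proof eventually_elim
    case (elim x)
    show ?case
    proof (cases "x \<in> feasible g")
      case True
      then obtain k where "\<not> F k x + Ivl 0 (\<epsilon> $ k * norm (x - z)) \<prec>\<^sub>C\<^sub>W F k z"
        using noCW elim by blast
      then have "\<psi> (Ctr k) z \<le> \<psi> (Ctr k) x + c (Ctr k) * norm (x - z) \<or>
          \<psi> (Width k) z \<le> \<psi> (Width k) x + c (Width k) * norm (x - z)"
        using eps[of k] by (auto simp: less_CW_add_Ivl_iff)
      then show ?thesis
        unfolding A_def by blast
    next
      case False
      then obtain j where "0 < g j x"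
        by (auto simp: feasible_def not_le)
      moreover from this have "j \<in> active g z"
        using elim by force
      ultimately show ?thesis
        unfolding A_def by (intro bexI[of _ "Constr j"]) (auto simp: active_def)
    qed
  qed
  obtain \<nu> s where \<nu>: "\<And>a. a \<in> A \<Longrightarrow> 0 \<le> \<nu> a" "sum \<nu> A = 1"
    and s: "\<And>a. a \<in> A \<Longrightarrow> s a \<in> Clarke_gradient (\<psi> a) z + cball 0 (c a)"
    and zero: "(\<Sum>a\<in>A. \<nu> a *\<^sub>R s a) = 0"
    using Fritz_John[OF \<open>finite A\<close> lip c0 ev] by blast
  \<comment> \<open>A vector is required for inactive constraints too; any Clarke subgradient will
    do, as its weight is 0.\<close>
  define v where "v j = (if j \<in> active g z then s (Constr j) else SOME d. d \<in> Clarke_gradient (g j) z)" for j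
  have v: "v j \<in> Clarke_gradient (g j) z" for j
  proof (cases "j \<in> active g z")
    case True
    \<comment> \<open>Constraints carry no perturbation, so the added ball has radius 0 and is the
      zero of set addition.\<close>
    with s[of "Constr j"] show ?thesis
      by (simp add: v_def A_def flip: set_zero)
  next
    case False
    then show ?thesis
      using Clarke_gradient_nonempty[OF g] by (auto simp: v_def some_in_eq)
  qed
  define \<mu>0 :: "real ^ 'p" where "\<mu>0 = (\<chi> j. if j \<in> active g z then \<nu> (Constr j) else 0)"
  define \<Lambda> where "\<Lambda> k = \<nu> (Ctr k) + \<nu> (Width k)" for k
  have \<mu>0: "0 \<le> \<mu>0 $ j" for j
    using \<nu>(1) by (simp add: \<mu>0_def A_def)
  have \<Lambda>0: "0 \<le> \<Lambda> k" for k
    using \<nu>(1) by (simp add: \<Lambda>_def A_def)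
  have sum1: "sum \<Lambda> UNIV + (\<Sum>j\<in>UNIV. \<mu>0 $ j) = 1"
    using \<nu>(2) by (simp add: A_def sum_parts \<Lambda>_def \<mu>0_def sum.distrib flip: sum.inter_filter sum.inter_restrict)
  have "(\<Sum>j\<in>UNIV. \<mu>0 $ j *\<^sub>R v j) = (\<Sum>j\<in>active g z. \<nu> (Constr j) *\<^sub>R s (Constr j))"
    by (rule sum.mono_neutral_cong_right) (auto simp: \<mu>0_def v_def)
  then have zero': "(\<Sum>k\<in>UNIV. \<nu> (Ctr k) *\<^sub>R s (Ctr k) + \<nu> (Width k) *\<^sub>R s (Width k)) +
      (\<Sum>j\<in>UNIV. \<mu>0 $ j *\<^sub>R v j) = 0"
    using zero by (simp add: A_def sum_parts sum.distrib)
  \<comment> \<open>Otherwise all weight, of total 1, would lie on active constraints, and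
    \<open>\<mu>0\<close> would be a multiplier forbidden by BCQ.\<close>
  have "sum \<Lambda> UNIV \<noteq> 0"
  proof
    assume \<Lambda>: "sum \<Lambda> UNIV = 0"
    then have "\<Lambda> k = 0" for k
      using \<Lambda>0 by (simp add: sum_nonneg_eq_0_iff)
    then have "\<nu> (Ctr k) = 0 \<and> \<nu> (Width k) = 0" for k
      using \<nu>(1)[of "Ctr k"] \<nu>(1)[of "Width k"] unfolding \<Lambda>_def A_def
      by (metis UnI1 UnI2 add_nonneg_eq_0_iff rangeI)
    then have "(\<Sum>j\<in>UNIV. \<mu>0 $ j *\<^sub>R v j) = 0"
      using zero' by simp
    then have "0 \<in> (\<Sum>j\<in>UNIV. (*\<^sub>R) (\<mu>0 $ j) ` Clarke_gradient (g j) z)"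
      unfolding set_sum_alt[OF finite] using v by (auto intro!: exI[of _ "\<lambda>j. \<mu>0 $ j *\<^sub>R v j"])
    moreover have "\<mu>0 \<noteq> 0"
      using sum1 \<Lambda> by auto
    ultimately show False
      using BCQ \<mu>0 unfolding BCQ_def by (metis (mono_tags, lifting) \<mu>0_def vec_lambda_beta)
  qed
  then have \<Lambda>_pos: "0 < sum \<Lambda> UNIV"
    using \<Lambda>0 by (simp add: less_le sum_nonneg)
  define W where "W k = weak_gradient (F k) z + (*\<^sub>R) (\<epsilon> $ k) ` cball 0 1" for k
  have "\<exists>u\<in>W k. \<Lambda> k *\<^sub>R u = \<nu> (Ctr k) *\<^sub>R s (Ctr k) + \<nu> (Width k) *\<^sub>R s (Width k)" for k
    unfolding \<Lambda>_def
  proof (rule convex_combination_scaled)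
    show "convex (W k)"
      unfolding W_def weak_gradient_def by (intro convex_set_plus convex_convex_hull convex_scaling convex_cball)
    \<comment> \<open>Both Clarke gradients lie in the weakly generalized gradient, and the ball of
      half radius in the scaled unit ball.\<close>
    have *: "s a \<in> W k" if "a \<in> A" "Clarke_gradient (\<psi> a) z \<subseteq> weak_gradient (F k) z" "c a = \<epsilon> $ k / 2" for a
      using subsetD[OF set_plus_mono2[OF that(2) cball_half_subset_scaleR_cball[OF eps]] s[OF that(1), unfolded that(3)]]
      unfolding W_def .
    show "s (Ctr k) \<in> W k" "s (Width k) \<in> W k"
      by (rule *; auto simp: A_def weak_gradient_def intro: hull_inc)+
    show "0 \<le> \<nu> (Ctr k)" "0 \<le> \<nu> (Width k)"
      using \<nu>(1) by (simp_all add: A_def)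
  qed
  then obtain u where u: "\<And>k. u k \<in> W k"
    and \<Lambda>u: "\<And>k. \<Lambda> k *\<^sub>R u k = \<nu> (Ctr k) *\<^sub>R s (Ctr k) + \<nu> (Width k) *\<^sub>R s (Width k)"
    by metis
  \<comment> \<open>Stationarity and complementarity are homogeneous in the multipliers, so dividing
    by the total objective weight preserves them.\<close>
  let ?r = "1 / sum \<Lambda> UNIV"
  have "(\<Sum>k\<in>UNIV. (\<chi> k. ?r * \<Lambda> k) $ k *\<^sub>R u k) + (\<Sum>j\<in>UNIV. (?r *\<^sub>R \<mu>0) $ j *\<^sub>R v j) =
      ?r *\<^sub>R ((\<Sum>k\<in>UNIV. \<Lambda> k *\<^sub>R u k) + (\<Sum>j\<in>UNIV. \<mu>0 $ j *\<^sub>R v j))"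
    by (simp add: scaleR_add_right scaleR_sum_right)
  also have "\<dots> = 0"
    using zero' by (simp add: \<Lambda>u)
  finally have stat: "(\<Sum>k\<in>UNIV. (\<chi> k. ?r * \<Lambda> k) $ k *\<^sub>R u k) + (\<Sum>j\<in>UNIV. (?r *\<^sub>R \<mu>0) $ j *\<^sub>R v j) = 0" .
  show thesis
  proof (rule that[OF _ allI[OF v] _ _ _ stat])
    show "(\<Sum>k\<in>UNIV. (\<chi> k. ?r * \<Lambda> k) $ k) = 1"
      using \<Lambda>_pos by (simp flip: sum_divide_distrib)
    show "(\<Sum>j\<in>UNIV. (?r *\<^sub>R \<mu>0) $ j * g j z) = 0"
      by (rule sum.neutral) (auto simp: \<mu>0_def active_def)
  qed (use u W_def \<Lambda>0 \<mu>0 \<Lambda>_pos in auto)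
qed

text \<open>The tolerance \<open>d i\<close> is indexed by the position in the subsequence, not by
  the original index, so each term is chosen far enough out, beyond the preceding one.\<close>

lemma subseq_dist_le:
  fixes x :: "nat \<Rightarrow> 'a::metric_space"
  assumes "x \<longlonglongrightarrow> l" "\<And>i. 0 < d i"
  obtains r :: "nat \<Rightarrow> nat" where "strict_mono r" "\<forall>i. dist (x (r i)) l \<le> d i"
proof -
  have "\<exists>n>m. dist (x n) l \<le> d i" for m i
  proof -
    have "\<forall>\<^sub>F n in sequentially. dist (x n) l < d i \<and> m < n"
      using tendstoD[OF assms(1,2)] eventually_gt_at_top by (rule eventually_conj)
    then show ?thesis
      by (auto dest!: eventually_happens intro: less_imp_le)
  qed
  then have "\<exists>r. \<forall>i. dist (x (r i)) l \<le> d i \<and> r i < r (Suc i)"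
    by (intro dependent_nat_choice) blast+
  then show thesis
    using that by (auto simp: strict_mono_Suc_iff)
qed

theorem corollary4p2:
  fixes F :: "'m::finite \<Rightarrow> real ^ 'n \<Rightarrow> real interval"
    and g :: "'p::finite \<Rightarrow> real ^ 'n \<Rightarrow> real"
    and \<epsilon> :: "real ^ 'm"
    and ubar :: "real ^ 'n"
    and e :: "nat \<Rightarrow> real"
    and x :: "nat \<Rightarrow> real ^ 'n"
  assumes "\<And>k. locally_Lipschitz_ivl (F k)"
    and "\<And>j. locally_Lipschitz (g j)"
    and "\<And>k. 0 \<le> \<epsilon> $ k" and "\<epsilon> \<noteq> 0"
    and "locally_weak_quasi_minimal F (feasible g) \<epsilon> ubar"
    and "\<exists>V. open V \<and> ubar \<in> V \<and> (\<forall>u \<in> V \<inter> feasible g. BCQ g u)"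
    and "\<And>i. e i > 0" and "e \<longlonglongrightarrow> 0"
    and "\<And>i. x i \<in> feasible g" and "x \<longlonglongrightarrow> ubar"
  shows "\<exists>r :: nat \<Rightarrow> nat. strict_mono r \<and>
    (\<forall>i. \<exists>y \<in> feasible g.
       norm (x (r i) - y) \<le> sqrt (e i) \<and>
       (\<exists>(u :: 'm \<Rightarrow> real ^ 'n) (v :: 'p \<Rightarrow> real ^ 'n) (lam :: real ^ 'm) (\<mu> :: real ^ 'p).
          (\<forall>k. u k \<in> weak_gradient (F k) y + (*\<^sub>R) (\<epsilon> $ k) ` cball 0 1) \<and>
          (\<forall>j. v j \<in> Clarke_gradient (g j) y) \<and>
          (\<forall>k. 0 \<le> lam $ k) \<and> (\<Sum>k\<in>UNIV. lam $ k) = 1 \<and>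
          (\<forall>j. 0 \<le> \<mu> $ j) \<and>
          norm ((\<Sum>k\<in>UNIV. lam $ k *\<^sub>R u k) + (\<Sum>j\<in>UNIV. \<mu> $ j *\<^sub>R v j)) \<le> sqrt (e i) \<and>
          (\<Sum>j\<in>UNIV. \<mu> $ j * g j y) = 0))"
proof -
  have ubar: "ubar \<in> feasible g"
    using assms(5) by (simp add: locally_weak_quasi_minimal_def)
  then have "BCQ g ubar"
    using assms(6) by blast
  then obtain u v and lam :: "real ^ 'm" and \<mu> :: "real ^ 'p" where kkt:
    "\<forall>k. u k \<in> weak_gradient (F k) ubar + (*\<^sub>R) (\<epsilon> $ k) ` cball 0 1"
    "\<forall>j. v j \<in> Clarke_gradient (g j) ubar"
    "\<forall>k. 0 \<le> lam $ k" "(\<Sum>k\<in>UNIV. lam $ k) = 1" "\<forall>j. 0 \<le> \<mu> $ j"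
    "(\<Sum>k\<in>UNIV. lam $ k *\<^sub>R u k) + (\<Sum>j\<in>UNIV. \<mu> $ j *\<^sub>R v j) = 0"
    "(\<Sum>j\<in>UNIV. \<mu> $ j * g j ubar) = 0"
    by (rule KKT_of_locally_weak_quasi_minimal[OF assms(1-3,5)])
  have sqrt_pos: "0 < sqrt (e i)" for i
    using assms(7) by simp
  obtain r where r: "strict_mono r" "\<forall>i. dist (x (r i)) ubar \<le> sqrt (e i)"
    by (rule subseq_dist_le[of x ubar "\<lambda>i. sqrt (e i)", OF assms(10) sqrt_pos])
  have near: "norm (x (r i) - ubar) \<le> sqrt (e i)" for i
    using r(2) by (simp add: dist_norm)
  \<comment> \<open>The same multipliers serve for every \<open>i\<close>, since the residual at
    \<open>ubar\<close> is exactly 0.\<close>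
  have stat: "norm ((\<Sum>k\<in>UNIV. lam $ k *\<^sub>R u k) + (\<Sum>j\<in>UNIV. \<mu> $ j *\<^sub>R v j)) \<le> sqrt (e i)" for i
    unfolding kkt(6) using sqrt_pos[of i] by simp
  show ?thesis
    by (intro exI[of _ r] conjI allI)
       (rule r(1), intro bexI[OF _ ubar] exI[of _ u] exI[of _ v] exI[of _ lam] exI[of _ \<mu>] conjI near kkt stat)
qed

end
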